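(* Let $(G,\upsilon,\varepsilon)$ be a weighted multigraph on $n$ vertices. Let $R\subseteq E$ and let $S\subseteq V$ be a subset of the isolated vertices of $G-R$, with $|S|=k$. Let $\lambda_1\le\dots\le\lambda_n$ and $\mu_1\le\dots\le\mu_{n-k}$ denote the weighted Laplacian eigenvalues (with multiplicity) of $(G,\upsilon,\varepsilon)$ and $(G-R-S,\upsilon,\varepsilon)$, respectively. Suppose $G[R]$ has $s$ vertices and $c$ connected components. Then $$\lambda_{i-s+c+k}\le\mu_i\le\lambda_{i+k}$$ for all $1\le i\le n-k$, where each inequality is asserted only when the eigenvalue $\lambda_j$ appearing in it is defined, i.e. $1\le j\le n$.
   Context: A graph is a finite multigraph with vertex set $V$ and edge set $E$ (loops and multiple edges allowed). A weighted multigraph $(G,\upsilon,\varepsilon)$ is a graph $G$ with vertex weights $\upsilon:V\to\mathbb R_{>0}$ and edge weights $\varepsilon:E\to\mathbb R_{>0}$. For $u,v\in V$, $\varepsilon(u,v)$ is the total edge weight between $u$ and $v$, with loops counted twice, and $d_{(G,\varepsilon)}(u)=\sum_{v\in V}\varepsilon(u,v)$. The combinatorial Laplacian is the $V\times V$ matrix $L_{(G,\varepsilon)}=D_{(G,\varepsilon)}-A_{(G,\varepsilon)}$, where $A_{(G,\varepsilon)}=(\varepsilon(u,v))_{u,v}$ and $D_{(G,\varepsilon)}$ is diagonal with entries $d_{(G,\varepsilon)}(v)$. The weighted Laplacian is $L_{(G,\upsilon,\varepsilon)}=W_\upsilon^{-1}L_{(G,\varepsilon)}$, where $W_\upsilon$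 is the diagonal matrix with entries $\upsilon(v)$; it is self-adjoint for the inner product $\langle f,g\rangle=\sum_{v}f(v)g(v)\upsilon(v)$, so its eigenvalues are real. An isolated vertex is a vertex of degree zero. $G-R$ is $G$ with the edges in $R$ removed (all vertices kept); $G-R-S$ is then obtained by removing the vertices in $S$. $G[R]$ is the subgraph consisting of the edges in $R$ and all vertices incident to them. Weights on subgraphs are inherited by restriction. *)

theory Defs
  imports
    "HOL-Library.Uprod"
    "HOL-Library.Multiset"
    "Jordan_Normal_Form.Char_Poly"
begin

(* An edge is sent to the unordered pair of its ends; a loop at u is sent to Upair u u. *)
record ('v, 'e) multigraph =
  verts :: "'v set"
  edges :: "'e set"
  ends :: "'e \<Rightarrow> 'v uprod"

definition multigraph :: "('v, 'e) multigraph \<Rightarrow> bool" where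
  "multigraph G \<longleftrightarrow> finite (verts G) \<and> finite (edges G) \<and>
     (\<forall>e\<in>edges G. set_uprod (ends G e) \<subseteq> verts G)"

definition weighted_multigraph ::
    "('v, 'e) multigraph \<Rightarrow> ('v \<Rightarrow> real) \<Rightarrow> ('e \<Rightarrow> real) \<Rightarrow> bool" where
  "weighted_multigraph G \<upsilon> \<epsilon> \<longleftrightarrow>
     multigraph G \<and> (\<forall>v\<in>verts G. \<upsilon> v > 0) \<and> (\<forall>e\<in>edges G. \<epsilon> e > 0)"

definition vertex_degree :: "('v, 'e) multigraph \<Rightarrow> 'v \<Rightarrow> nat" where
  "vertex_degree G v = card {e \<in> edges G. v \<in> set_uprod (ends G e)}
              + card {e \<in> edges G. ends G e = Upair v v}"

definition isolated_verts :: "('v, 'e) multigraph \<Rightarrow> 'v set" where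
  "isolated_verts G = {v \<in> verts G. vertex_degree G v = 0}"

definition del_edges :: "('v, 'e) multigraph \<Rightarrow> 'e set \<Rightarrow> ('v, 'e) multigraph" where
  "del_edges G R = G\<lparr>edges := edges G - R\<rparr>"

definition del_verts :: "('v, 'e) multigraph \<Rightarrow> 'v set \<Rightarrow> ('v, 'e) multigraph" where
  "del_verts G S = G\<lparr>verts := verts G - S,
     edges := {e \<in> edges G. set_uprod (ends G e) \<inter> S = {}}\<rparr>"

definition edge_subgraph :: "('v, 'e) multigraph \<Rightarrow> 'e set \<Rightarrow> ('v, 'e) multigraph" where
  "edge_subgraph G R = G\<lparr>verts := (\<Union>e\<in>R. set_uprod (ends G e)), edges := R\<rparr>"

definition adjacency :: "('v, 'e) multigraph \<Rightarrow> 'v rel" where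
  "adjacency G = {(u, v). \<exists>e\<in>edges G. ends G e = Upair u v}"

definition connected_rel :: "('v, 'e) multigraph \<Rightarrow> 'v rel" where
  "connected_rel G = {(u, v). u \<in> verts G \<and> v \<in> verts G \<and> (u, v) \<in> (adjacency G)\<^sup>*}"

(* Each component is represented by its vertex set. *)
definition components :: "('v, 'e) multigraph \<Rightarrow> 'v set set" where
  "components G = verts G // connected_rel G"

definition edge_weight :: "('v, 'e) multigraph \<Rightarrow> ('e \<Rightarrow> real) \<Rightarrow> 'v \<Rightarrow> 'v \<Rightarrow> real" where
  "edge_weight G \<epsilon> u v =
     (if u = v then 2 else 1) * (\<Sum>e\<in>{e \<in> edges G. ends G e = Upair u v}. \<epsilon> e)"

definition weighted_degree :: "('v, 'e) multigraph \<Rightarrow> ('e \<Rightarrow> real) \<Rightarrow> 'v \<Rightarrow> real" where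
  "weighted_degree G \<epsilon> u = (\<Sum>v\<in>verts G. edge_weight G \<epsilon> u v)"

definition laplacian :: "('v, 'e) multigraph \<Rightarrow> ('e \<Rightarrow> real) \<Rightarrow> 'v \<Rightarrow> 'v \<Rightarrow> real" where
  "laplacian G \<epsilon> u v = (if u = v then weighted_degree G \<epsilon> u else 0) - edge_weight G \<epsilon> u v"

(* The inverse of the diagonal matrix of vertex weights acts by scaling rows. *)
definition weighted_laplacian ::
    "('v, 'e) multigraph \<Rightarrow> ('v \<Rightarrow> real) \<Rightarrow> ('e \<Rightarrow> real) \<Rightarrow> 'v \<Rightarrow> 'v \<Rightarrow> real" where
  "weighted_laplacian G \<upsilon> \<epsilon> u v = inverse (\<upsilon> u) * laplacian G \<epsilon> u v"

(* A matrix indexed by vertices becomes a library matrix through a list vs of the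
   vertices without repetition; other lists give a conjugate by a permutation matrix. *)
definition weighted_laplacian_mat ::
    "'v list \<Rightarrow> ('v, 'e) multigraph \<Rightarrow> ('v \<Rightarrow> real) \<Rightarrow> ('e \<Rightarrow> real) \<Rightarrow> real mat" where
  "weighted_laplacian_mat vs G \<upsilon> \<epsilon> =
     mat (length vs) (length vs) (\<lambda>(i, j). weighted_laplacian G \<upsilon> \<epsilon> (vs ! i) (vs ! j))"

(* Real eigenvalues with algebraic multiplicity, in increasing order.  The weighted
   Laplacian is self-adjoint for the inner product with weights \<upsilon>, so that these are
   all of its eigenvalues. *)
definition real_eigenvalues :: "real mat \<Rightarrow> real list" where
  "real_eigenvalues A = sorted_list_of_multiset (proots (char_poly A))"

(* Indices count from 1, and are integers because index shifts may leave the range; the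
   value is meaningful only if j is between 1 and the number of vertices. *)
definition laplacian_eigenvalue ::
    "'v list \<Rightarrow> ('v, 'e) multigraph \<Rightarrow> ('v \<Rightarrow> real) \<Rightarrow> ('e \<Rightarrow> real) \<Rightarrow> int \<Rightarrow> real" where
  "laplacian_eigenvalue vs G \<upsilon> \<epsilon> j =
     real_eigenvalues (weighted_laplacian_mat vs G \<upsilon> \<epsilon>) ! nat (j - 1)"

end

theory Submission
  imports Defs "Jordan_Normal_Form.Spectral_Radius"
begin

text \<open>
  The Laplacian belongs to the Dirichlet energy
  \<open>E\<^sub>G(f) = (1/2) (\<Sum>u v. \<epsilon>(u,v) (f u - f v)\<^sup>2)\<close>, and the weighted Laplacian represents this
  quadratic form in the inner product with weights \<open>\<upsilon>\<close>.  The spectral theorem therefore gives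
  functions on the vertices, orthonormal for that inner product, in which \<open>E\<^sub>G\<close> is the sum of the
  eigenvalues times squared coefficients (\<open>weighted_laplacian_orthonormal_diagonalization\<close>).

  With such bases for \<open>G\<close> and \<open>H = G - R - S\<close> both inequalities follow by counting linear
  equations on a function \<open>f\<close> on the \<open>n\<close> vertices of \<open>G\<close>, where fewer than \<open>n\<close> equations leave
  a nonzero \<open>f\<close>.  Deleting isolated vertices leaves the energy alone, so \<open>E\<^sub>G = E\<^sub>H + E\<^sub>R\<close> for the
  energy \<open>E\<^sub>R \<ge> 0\<close> of \<open>G[R]\<close>.

  For \<open>\<mu>\<^sub>i \<le> \<lambda>\<^sub>i\<^sub>+\<^sub>k\<close> require \<open>f = 0\<close> on \<open>S\<close> (\<open>k\<close> equations), \<open>f\<close> orthogonal to the first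
  \<open>i - 1\<close> eigenfunctions of \<open>H\<close>, and \<open>f\<close> orthogonal to the last \<open>n - i - k\<close> eigenfunctions
  of \<open>G\<close>.  A nonzero solution satisfies \<open>\<mu>\<^sub>i |f|\<^sup>2 \<le> E\<^sub>H(f) \<le> E\<^sub>G(f) \<le> \<lambda>\<^sub>i\<^sub>+\<^sub>k |f|\<^sup>2\<close>.

  For the lower bound put \<open>j = i - s + c + k\<close> and require \<open>f\<close> to be constant on the
  components of \<open>G[R]\<close>, which takes \<open>s - c\<close> equations and makes \<open>E\<^sub>R(f) = 0\<close>, to be orthogonal
  to the first \<open>j - 1\<close> eigenfunctions of \<open>G\<close>, and to be orthogonal to the last \<open>n - k - i\<close>
  eigenfunctions of \<open>H\<close>.  Then
  \<open>\<lambda>\<^sub>j |f|\<^sup>2 \<le> E\<^sub>G(f) = E\<^sub>H(f) \<le> \<mu>\<^sub>i |f|\<^sub>H\<^sup>2 \<le> \<mu>\<^sub>i |f|\<^sup>2\<close>; the last step uses \<open>\<mu>\<^sub>i \<ge> 0\<close>, since the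
  norm \<open>|f|\<^sub>H\<close> over the vertices of \<open>H\<close> omits \<open>S\<close>.  In both cases there are \<open>n - 1\<close> equations.
\<close>

section \<open>The spectral theorem for real symmetric matrices\<close>

text \<open>
  Over the complex numbers an eigenvalue \<open>z\<close> with eigenvector \<open>x\<close> always exists.  Symmetry
  makes the Hermitian form \<open>x\<^sup>* M x = z |x|\<^sup>2\<close> equal to its own conjugate, so \<open>z\<close> is real.
\<close>

lemma symmetric_real_eigenvalue_exists:
  fixes M :: "real mat"
  assumes M: "M \<in> carrier_mat n n" and sym: "M\<^sup>T = M" and n: "n > 0"
  obtains e where "poly (char_poly M) e = 0"
proof -
  let ?A = "map_mat complex_of_real M"
  have A: "?A \<in> carrier_mat n n" using M by simp
  from spectrum_non_empty[OF A n] obtain z where z: "eigenvalue ?A z"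
    unfolding spectrum_def by auto
  then obtain x where x: "x \<in> carrier_vec n" "x \<noteq> 0\<^sub>v n" "?A *\<^sub>v x = z \<cdot>\<^sub>v x"
    unfolding eigenvalue_def eigenvector_def using A by auto
  have Mij: "M $$ (j, i) = M $$ (i, j)" if "i < n" "j < n" for i j
    using sym M that by (metis carrier_matD index_transpose_mat(1))
  have row: "(\<Sum>j<n. of_real (M $$ (i, j)) * x $ j) = z * x $ i" if i: "i < n" for i
  proof -
    have "(?A *\<^sub>v x) $ i = (z \<cdot>\<^sub>v x) $ i" using x by simp
    thus ?thesis using i M x(1) by (simp add: scalar_prod_def atLeast0LessThan)
  qed
  define N where "N = (\<Sum>i<n. cnj (x $ i) * x $ i)"
  have "(\<Sum>i<n. \<Sum>j<n. cnj (x $ i) * of_real (M $$ (i, j)) * x $ j)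
      = (\<Sum>i<n. cnj (x $ i) * (z * x $ i))"
    by (intro sum.cong refl) (simp add: row[symmetric] sum_distrib_left mult.assoc)
  hence 1: "(\<Sum>i<n. \<Sum>j<n. cnj (x $ i) * of_real (M $$ (i, j)) * x $ j) = z * N"
    by (simp add: N_def sum_distrib_left algebra_simps)
  have "cnj (\<Sum>i<n. \<Sum>j<n. cnj (x $ i) * of_real (M $$ (i, j)) * x $ j)
      = (\<Sum>i<n. \<Sum>j<n. cnj (x $ j) * of_real (M $$ (i, j)) * x $ i)"
    by (simp add: mult.commute mult.left_commute)
  also have "\<dots> = (\<Sum>i<n. \<Sum>j<n. cnj (x $ i) * of_real (M $$ (i, j)) * x $ j)"
    by (subst sum.swap) (simp add: Mij cong: sum.cong_simp)
  finally have 2: "cnj (z * N) = z * N" using 1 by simp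
  have Nr: "N = of_real (\<Sum>i<n. (cmod (x $ i))\<^sup>2)"
    unfolding N_def by (simp only: of_real_sum complex_norm_square) (simp add: mult.commute)
  have "N \<noteq> 0"
  proof
    assume "N = 0"
    hence "(\<Sum>i<n. (cmod (x $ i))\<^sup>2) = 0" using Nr by (metis of_real_eq_0_iff)
    hence "\<forall>i<n. x $ i = 0" by (subst (asm) sum_nonneg_eq_0_iff) auto
    hence "x = 0\<^sub>v n" using x(1) by auto
    with x show False by simp
  qed
  moreover have "cnj N = N" by (simp add: Nr)
  ultimately have "cnj z = z" using 2 by simp
  then obtain e where e: "z = of_real e" by (metis Reals_cnj_iff Reals_cases)
  have "poly (char_poly ?A) z = 0" using z eigenvalue_root_char_poly[OF A] by simp
  hence "poly (char_poly M) e = 0"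
    unfolding e of_real_hom.char_poly_hom[OF M] by simp
  thus thesis by (rule that)
qed

text \<open>
  The reflection that exchanges the first unit vector and \<open>v\<close> provides an orthonormal basis
  beginning with \<open>v\<close> by an explicit formula.  If \<open>v\<close> already is the first unit vector, then
  \<open>w = 0\<close> and \<open>c = 0\<close>, and division by zero turns the formula into the identity matrix.
\<close>

lemma householder_reflection:
  fixes v :: "real vec"
  assumes v: "v \<in> carrier_vec n" and nrm: "v \<bullet> v = 1" and n: "n > 0"
  obtains P where "P \<in> carrier_mat n n" "P\<^sup>T = P" "P * P = 1\<^sub>m n" "col P 0 = v"
proof -
  define w where "w i = v $ i - (if i = 0 then 1 else 0)" for i
  define c where "c = 1 - v $ 0"
  define P where "P = mat n n (\<lambda>(i, j). (if i = j then 1 else 0) - w i * w j / c)"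
  have vv: "(\<Sum>i<n. v $ i * v $ i) = 1"
    using nrm v by (simp add: scalar_prod_def atLeast0LessThan)
  have "(\<Sum>i<n. w i * w i) = (\<Sum>i<n. v $ i * v $ i + (if i = 0 then 1 - 2 * v $ 0 else 0))"
    by (intro sum.cong refl) (simp add: w_def algebra_simps)
  also have "\<dots> = 2 * c" using n by (simp add: sum.distrib vv c_def)
  finally have ww: "(\<Sum>i<n. w i * w i) = 2 * c" .
  have w0: "w i = 0" if "c = 0" "i < n" for i
  proof -
    have "(\<Sum>i<n. w i * w i) = 0" using ww that by simp
    thus ?thesis using that by (subst (asm) sum_nonneg_eq_0_iff) auto
  qed
  have PP: "P * P = 1\<^sub>m n"
  proof (rule eq_matI)
    fix i j assume ij: "i < dim_row (1\<^sub>m n :: real mat)" "j < dim_col (1\<^sub>m n :: real mat)"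
    hence ij: "i < n" "j < n" by auto
    have "(P * P) $$ (i, j) = (\<Sum>k<n. ((if i = k then 1 else 0) - w i * w k / c)
                * ((if k = j then 1 else 0) - w k * w j / c))"
      using ij by (simp add: P_def scalar_prod_def atLeast0LessThan)
    also have "\<dots> = (\<Sum>k<n. (if k = i then (if i = j then 1 else 0) - w i * w j / c else 0)
         - (if k = j then w i * w j / c else 0) + w i * w j / c^2 * (w k * w k))"
      by (intro sum.cong refl) (auto simp: algebra_simps power2_eq_square)
    also have "\<dots> = (if i = j then 1 else 0) - 2 * (w i * w j / c) + w i * w j / c^2 * (2 * c)"
      using ij by (simp add: sum.distrib sum_subtractf sum_distrib_left[symmetric] ww del: times_divide_eq_left)
    also have "\<dots> = (if i = j then 1 else 0)"
      by (cases "c = 0") (simp_all add: power2_eq_square)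
    finally show "(P * P) $$ (i, j) = 1\<^sub>m n $$ (i, j)" using ij by simp
  qed (auto simp: P_def)
  have col: "col P 0 = v"
  proof (rule eq_vecI)
    fix i assume "i < dim_vec v"
    hence i: "i < n" using v by simp
    have "col P 0 $ i = (if i = 0 then 1 else 0) - w i * w 0 / c" using i n by (simp add: P_def)
    also have "w i * w 0 / c = - w i"
      using w0[of i] i by (cases "c = 0") (auto simp: w_def[of 0] c_def field_simps)
    finally show "col P 0 $ i = v $ i" by (simp add: w_def)
  qed (use v in \<open>auto simp: P_def\<close>)
  show thesis
    by (rule that[of P]) (use PP col in \<open>auto simp: P_def mult.commute\<close>)
qed

lemma char_poly_similar_diag:
  fixes A :: "'a :: field mat"
  assumes "similar_mat A (mat_diag n (\<lambda>i. es ! i))" "length es = n"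
  shows "char_poly A = (\<Prod>a\<leftarrow>es. [:- a, 1:])"
proof -
  let ?D = "mat_diag n (\<lambda>i. es ! i)"
  have "char_poly A = char_poly ?D" using assms by (intro char_poly_similar)
  also have "\<dots> = (\<Prod>a\<leftarrow>diag_mat ?D. [:- a, 1:])"
    by (rule char_poly_upper_triangular[of _ n]) (auto simp: mat_diag_def upper_triangular_def)
  also have "diag_mat ?D = es"
    using assms by (auto simp: diag_mat_def mat_diag_def intro!: nth_equalityI)
  finally show ?thesis .
qed

text \<open>
  Deflation: conjugating by a reflection that sends the first unit vector to a unit eigenvector
  splits off a \<open>1 \<times> 1\<close> block, and symmetry is inherited by the remaining block.  The eigenvalue
  split off is the smallest one; the eigenvalues of the remaining block are eigenvalues of \<open>M\<close>
  too, and so the diagonal comes out sorted.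
\<close>

theorem real_spectral_theorem:
  fixes M :: "real mat"
  assumes "M \<in> carrier_mat n n" and "M\<^sup>T = M"
  shows "\<exists>U es. length es = n \<and> sorted es \<and> similar_mat_wit M (mat_diag n (\<lambda>i. es ! i)) U (U\<^sup>T)"
  using assms
proof (induction n arbitrary: M)
  case 0
  have "similar_mat_wit M (mat_diag 0 (\<lambda>i. [] ! i)) (1\<^sub>m 0) ((1\<^sub>m 0)\<^sup>T)"
    using 0 by (intro similar_mat_witI[of _ _ 0]) (auto intro!: eq_matI)
  thus ?case by (intro exI[of _ "1\<^sub>m 0"] exI[of _ "[]"]) auto
next
  case (Suc n)
  note M = Suc.prems(1)
  have p0: "char_poly M \<noteq> 0" using degree_monic_char_poly[OF M] by auto
  define e where "e = Min {x. poly (char_poly M) x = 0}"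
  have fin: "finite {x. poly (char_poly M) x = 0}" using p0 by (rule poly_roots_finite)
  have "{x. poly (char_poly M) x = 0} \<noteq> {}"
    using symmetric_real_eigenvalue_exists[OF Suc.prems] by blast
  from Min_in[OF fin this] have e: "poly (char_poly M) e = 0" by (simp add: e_def)
  have emin: "e \<le> x" if "poly (char_poly M) x = 0" for x
    unfolding e_def using fin that by (intro Min_le) auto
  from e have "eigenvalue M e" using eigenvalue_root_char_poly[OF M] by simp
  then obtain y where y: "y \<in> carrier_vec (Suc n)" "y \<noteq> 0\<^sub>v (Suc n)" "M *\<^sub>v y = e \<cdot>\<^sub>v y"
    unfolding eigenvalue_def eigenvector_def using M by auto
  have yy: "y \<bullet> y > 0" 
  proof -
    have "y \<bullet>c y > 0" using conjugate_square_greater_0_vec[OF y(1)] y(2) by simp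
    thus ?thesis by simp
  qed
  define v where "v = (1 / sqrt (y \<bullet> y)) \<cdot>\<^sub>v y"
  have v: "v \<in> carrier_vec (Suc n)" using y by (simp add: v_def)
  have "v \<bullet> v = (1 / sqrt (y \<bullet> y)) * ((1 / sqrt (y \<bullet> y)) * (y \<bullet> y))"
    unfolding v_def using y(1) by (simp add: scalar_prod_smult_left scalar_prod_smult_right)
  also have "\<dots> = 1" using yy by (simp add: field_simps)
  finally have vv: "v \<bullet> v = 1" .
  have Mv: "M *\<^sub>v v = e \<cdot>\<^sub>v v"
    unfolding v_def using M y by (simp add: mult_mat_vec smult_smult_assoc mult.commute)
  obtain P where P: "P \<in> carrier_mat (Suc n) (Suc n)" "P\<^sup>T = P" "P * P = 1\<^sub>m (Suc n)" "col P 0 = v"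
    using householder_reflection[OF v vv] by blast
  define N where "N = P * M * P"
  have N: "N \<in> carrier_mat (Suc n) (Suc n)" using P M by (simp add: N_def)
  have "N\<^sup>T = P\<^sup>T * (M\<^sup>T * P\<^sup>T)" 
    unfolding N_def using P(1) M by (simp add: transpose_mult[of _ "Suc n" "Suc n" _ "Suc n"])
  hence NT: "N\<^sup>T = N" using P M Suc.prems(2) by (simp add: N_def assoc_mult_mat[of _ "Suc n" "Suc n" _ "Suc n" _ "Suc n"])
  have simMN: "similar_mat_wit M N P P"
  proof (rule similar_mat_witI[of _ _ "Suc n"])
    have "P * N * P = (P * P) * M * (P * P)"
      unfolding N_def using P(1) M by (simp add: assoc_mult_mat[of _ "Suc n" "Suc n" _ "Suc n" _ "Suc n"])
    thus "M = P * N * P" using P M by simp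
  qed (use P M N in auto)
  have "col N 0 = P * M *\<^sub>v v"
    unfolding N_def using P M by (subst col_mult2[of _ "Suc n" "Suc n"]) auto
  also have "\<dots> = P *\<^sub>v (e \<cdot>\<^sub>v v)" using P M v Mv by (subst assoc_mult_mat_vec) auto
  also have "\<dots> = e \<cdot>\<^sub>v (P *\<^sub>v v)" using P v by (simp add: mult_mat_vec)
  also have "P *\<^sub>v v = col (P * P) 0" using P by (subst col_mult2[of _ "Suc n" "Suc n"]) auto
  also have "\<dots> = unit_vec (Suc n) 0" using P by simp
  finally have colN: "col N 0 = e \<cdot>\<^sub>v unit_vec (Suc n) 0" .
  have N0: "N $$ (i, 0) = (if i = 0 then e else 0)" if "i < Suc n" for i
    using arg_cong[OF colN, of "\<lambda>x. x $ i"] N that by auto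
  have Nsym: "N $$ (j, i) = N $$ (i, j)" if "i < Suc n" "j < Suc n" for i j
    using NT N that by (metis carrier_matD index_transpose_mat(1))
  \<comment> \<open>The first column of \<open>N\<close> vanishes below the diagonal, and by symmetry so does the first row.\<close>
  define K where "K = mat n n (\<lambda>(i, j). N $$ (Suc i, Suc j))"
  have K: "K \<in> carrier_mat n n" by (simp add: K_def)
  have KT: "K\<^sup>T = K" by (rule eq_matI) (auto simp: K_def Nsym)
  let ?E = "mat_diag 1 (\<lambda>_. e)"
  have Nblock: "N = four_block_mat ?E (0\<^sub>m 1 n) (0\<^sub>m n 1) K"
  proof (rule eq_matI)
    fix i j assume "i < dim_row (four_block_mat ?E (0\<^sub>m 1 n) (0\<^sub>m n 1) K)"
      "j < dim_col (four_block_mat ?E (0\<^sub>m 1 n) (0\<^sub>m n 1) K)"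
    hence "i < Suc n" "j < Suc n" using K by (auto simp: mat_diag_def)
    thus "N $$ (i, j) = four_block_mat ?E (0\<^sub>m 1 n) (0\<^sub>m n 1) K $$ (i, j)"
      using N0[of i] N0[of j] Nsym[of j i] K by (cases i; cases j) (auto simp: mat_diag_def K_def)
  qed (use N K in \<open>auto simp: mat_diag_def\<close>)
  have "char_poly N = char_poly ?E * char_poly K"
    unfolding Nblock by (rule char_poly_four_block_zeros_col) (auto simp: K)
  moreover have "char_poly M = char_poly N"
    using simMN by (intro char_poly_similar) (auto simp: similar_mat_def)
  ultimately have sub: "poly (char_poly M) x = 0" if "poly (char_poly K) x = 0" for x
    using that by simp
  from Suc.IH[OF K KT] obtain U es where U: "length es = n" "sorted es"
      "similar_mat_wit K (mat_diag n (\<lambda>i. es ! i)) U (U\<^sup>T)" by blast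
  have Uc: "U \<in> carrier_mat n n" using similar_mat_witD2[OF K U(3)] by auto
  let ?D = "mat_diag n (\<lambda>i. es ! i)"
  have cpK: "char_poly K = (\<Prod>a\<leftarrow>es. [:- a, 1:])"
    using U by (intro char_poly_similar_diag[of _ n]) (auto simp: similar_mat_def)
  have "e \<le> x" if "x \<in> set es" for x
    by (rule emin, rule sub) (use that in \<open>auto simp: cpK poly_prod_list prod_list_zero_iff\<close>)
  hence srt: "sorted (e # es)" using U(2) by simp
  define V where "V = four_block_mat (1\<^sub>m 1) (0\<^sub>m 1 n) (0\<^sub>m n 1) U"
  have V: "V \<in> carrier_mat (Suc n) (Suc n)" using Uc four_block_carrier_mat[of "1\<^sub>m 1" 1 1 U n n]
    by (simp add: V_def)
  have VT: "V\<^sup>T = four_block_mat (1\<^sub>m 1) (0\<^sub>m 1 n) (0\<^sub>m n 1) (U\<^sup>T)"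
    unfolding V_def using Uc by (subst transpose_four_block_mat[of _ 1 1 _ n _ n]) auto
  have "similar_mat_wit N (four_block_mat ?E (0\<^sub>m 1 n) (0\<^sub>m n 1) ?D) V (V\<^sup>T)"
    unfolding Nblock VT unfolding V_def
    by (rule similar_mat_wit_four_block[OF similar_mat_wit_refl[of _ 1] U(3)])
      (use Uc K in auto)
  moreover have "four_block_mat ?E (0\<^sub>m 1 n) (0\<^sub>m n 1) ?D = mat_diag (Suc n) (\<lambda>i. (e # es) ! i)"
    by (rule eq_matI) (auto simp: mat_diag_def nth_Cons split: nat.splits)
  ultimately have "similar_mat_wit N (mat_diag (Suc n) (\<lambda>i. (e # es) ! i)) V (V\<^sup>T)" by simp
  from similar_mat_wit_trans[OF simMN this]
  have "similar_mat_wit M (mat_diag (Suc n) (\<lambda>i. (e # es) ! i)) (P * V) (V\<^sup>T * P)" .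
  moreover have "V\<^sup>T * P = (P * V)\<^sup>T"
    using P V by (simp add: transpose_mult[of _ "Suc n" "Suc n" _ "Suc n"])
  ultimately show ?case using srt U(1)
    by (intro exI[of _ "P * V"] exI[of _ "e # es"]) auto
qed

lemma real_eigenvalues_similar_diag:
  assumes "similar_mat A (mat_diag n (\<lambda>i. es ! i))" "length es = n" "sorted es"
  shows "real_eigenvalues A = es"
proof -
  have "proots (\<Prod>a\<leftarrow>es. [:- a, 1:]) = mset es"
  proof (induction es)
    case (Cons a es)
    have "(\<Prod>a\<leftarrow>es. [:- a, 1:]) \<noteq> 0" by (auto simp: prod_list_zero_iff)
    with Cons show ?case by (simp add: proots_mult del: mult_pCons_left)
  qed simp
  thus ?thesis using assms(3)
    by (simp add: real_eigenvalues_def char_poly_similar_diag[OF assms(1,2)] sorted_sort_id)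
qed

section \<open>Homogeneous linear systems\<close>

text \<open>
  Gaussian elimination, one functional at a time: a functional that is nonzero at \<open>w\<close> determines
  \<open>f w\<close> from the other values, which removes one equation and one unknown.
\<close>

lemma homogeneous_system_nontrivial_solution:
  fixes as :: "('v \<Rightarrow> 'a :: field) list"
  assumes "finite V" "length as < card V"
  obtains f where "\<exists>v\<in>V. f v \<noteq> 0" "\<And>a. a \<in> set as \<Longrightarrow> (\<Sum>v\<in>V. a v * f v) = 0"
proof -
  have "\<exists>f. (\<exists>v\<in>V. f v \<noteq> 0) \<and> (\<forall>a\<in>set as. (\<Sum>v\<in>V. a v * f v) = 0)"
    using assms
  proof (induction "length as" arbitrary: as V)
    case 0
    thus ?case by (intro exI[of _ "\<lambda>_. 1"]) (auto simp: card_gt_0_iff)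
  next
    case (Suc m)
    then obtain b bs where as: "as = b # bs" by (cases as) auto
    show ?case
    proof (cases "\<forall>v\<in>V. b v = 0")
      case True
      with Suc.hyps(1)[of bs V] Suc.hyps(2) Suc.prems as show ?thesis by force
    next
      case False
      then obtain w where w: "w \<in> V" "b w \<noteq> 0" by blast
      define el where "el a v = a v - a w / b w * b v" for a v
      have "length (map el bs) < card (V - {w})" using Suc.prems as w by simp
      with Suc.hyps(1)[of "map el bs" "V - {w}"] Suc.hyps(2) Suc.prems as
      obtain f where f: "\<exists>v\<in>V - {w}. f v \<noteq> 0"
        "\<And>a. a \<in> set bs \<Longrightarrow> (\<Sum>v\<in>V - {w}. el a v * f v) = 0" by fastforce
      define B where "B = (\<Sum>v\<in>V - {w}. b v * f v)"
      define g where "g = f(w := - B / b w)"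
      have split: "(\<Sum>v\<in>V. a v * g v) = a w * (- B / b w) + (\<Sum>v\<in>V - {w}. a v * f v)" for a
        using Suc.prems w by (subst sum.remove[of _ w]) (auto simp: g_def)
      have "(\<Sum>v\<in>V. a v * g v) = 0" if a: "a \<in> set bs" for a
      proof -
        have "0 = (\<Sum>v\<in>V - {w}. a v * f v) - a w / b w * B"
          using f(2)[OF a] by (simp add: el_def B_def left_diff_distrib sum_subtractf sum_distrib_left mult.assoc)
        thus ?thesis by (simp add: split)
      qed
      moreover have "(\<Sum>v\<in>V. b v * g v) = 0" using w by (simp add: split B_def)
      moreover have "\<exists>v\<in>V. g v \<noteq> 0" using f(1) by (auto simp: g_def)
      ultimately show ?thesis by (intro exI[of _ g]) (auto simp: as)
    qed
  qed
  thus thesis using that by blast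
qed

section \<open>Eigenfunctions of the weighted Laplacian\<close>

definition dirichlet_energy ::
    "('v, 'e) multigraph \<Rightarrow> ('e \<Rightarrow> real) \<Rightarrow> ('v \<Rightarrow> real) \<Rightarrow> real" where
  "dirichlet_energy G \<epsilon> f =
     (\<Sum>u\<in>verts G. \<Sum>v\<in>verts G. edge_weight G \<epsilon> u v * (f u - f v)\<^sup>2) / 2"

definition weighted_sq_norm ::
    "('v, 'e) multigraph \<Rightarrow> ('v \<Rightarrow> real) \<Rightarrow> ('v \<Rightarrow> real) \<Rightarrow> real" where
  "weighted_sq_norm G \<upsilon> f = (\<Sum>v\<in>verts G. \<upsilon> v * (f v)\<^sup>2)"

lemma edge_weight_commute: "edge_weight G \<epsilon> u v = edge_weight G \<epsilon> v u"
proof -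
  have "Upair u v = Upair v u" by simp
  thus ?thesis by (simp only: edge_weight_def eq_commute[of u v])
qed

lemma edge_weight_nonneg:
  assumes "\<forall>e\<in>edges G. \<epsilon> e > 0"
  shows "edge_weight G \<epsilon> u v \<ge> 0"
  unfolding edge_weight_def using assms
  by (intro mult_nonneg_nonneg sum_nonneg) (auto intro: less_imp_le)

lemma dirichlet_energy_eq_laplacian_form:
  assumes "finite (verts G)"
  shows "dirichlet_energy G \<epsilon> f =
    (\<Sum>u\<in>verts G. \<Sum>v\<in>verts G. f u * laplacian G \<epsilon> u v * f v)"
proof -
  let ?V = "verts G" and ?w = "edge_weight G \<epsilon>"
  let ?Q = "\<Sum>u\<in>?V. \<Sum>v\<in>?V. ?w u v * (f u)\<^sup>2"
  let ?C = "\<Sum>u\<in>?V. \<Sum>v\<in>?V. ?w u v * f u * f v"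
  have "(\<Sum>u\<in>?V. \<Sum>v\<in>?V. ?w u v * (f v)\<^sup>2) = ?Q"
    by (subst sum.swap) (simp add: edge_weight_commute)
  moreover have "(\<Sum>u\<in>?V. \<Sum>v\<in>?V. ?w u v * (f u - f v)\<^sup>2) =
      ?Q + (\<Sum>u\<in>?V. \<Sum>v\<in>?V. ?w u v * (f v)\<^sup>2) - 2 * ?C"
    by (simp add: power2_eq_square algebra_simps sum.distrib sum_subtractf sum_distrib_left)
  ultimately have "dirichlet_energy G \<epsilon> f = ?Q - ?C"
    by (simp add: dirichlet_energy_def)
  also have "?Q = (\<Sum>u\<in>?V. \<Sum>v\<in>?V. if u = v then f u * weighted_degree G \<epsilon> u * f v else 0)"
    by (rule sum.cong[OF refl])
      (simp add: assms weighted_degree_def sum_distrib_left sum_distrib_right power2_eq_square mult_ac)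
  also have "\<dots> - ?C = (\<Sum>u\<in>?V. \<Sum>v\<in>?V. f u * laplacian G \<epsilon> u v * f v)"
    unfolding sum_subtractf[symmetric]
    by (intro sum.cong refl) (simp add: laplacian_def algebra_simps)
  finally show ?thesis .
qed

text \<open>
  \<open>W\<^sup>-\<^sup>1 L\<close> is not symmetric, but conjugating by \<open>W\<^sup>1\<^sup>/\<^sup>2\<close> yields \<open>W\<^sup>-\<^sup>1\<^sup>/\<^sup>2 L W\<^sup>-\<^sup>1\<^sup>/\<^sup>2\<close>, to which the
  spectral theorem applies.
\<close>

lemma weighted_laplacian_similar_symmetrized:
  assumes "weighted_multigraph G \<upsilon> \<epsilon>" and "set vs = verts G"
  defines "M \<equiv> mat (length vs) (length vs) (\<lambda>(i, j).
    laplacian G \<epsilon> (vs ! i) (vs ! j) / (sqrt (\<upsilon> (vs ! i)) * sqrt (\<upsilon> (vs ! j))))"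
  shows "similar_mat (weighted_laplacian_mat vs G \<upsilon> \<epsilon>) M"
proof -
  let ?n = "length vs"
  let ?T = "mat_diag ?n (\<lambda>i. sqrt (\<upsilon> (vs ! i)))" and ?T' = "mat_diag ?n (\<lambda>i. 1 / sqrt (\<upsilon> (vs ! i)))"
  let ?A = "weighted_laplacian_mat vs G \<upsilon> \<epsilon>"
  have pos: "\<upsilon> (vs ! i) > 0" if "i < ?n" for i
    using assms that by (auto simp: weighted_multigraph_def)
  have A: "?A \<in> carrier_mat ?n ?n" and M: "M \<in> carrier_mat ?n ?n"
    by (auto simp: weighted_laplacian_mat_def M_def)
  have "similar_mat_wit ?A M ?T' ?T"
  proof (rule similar_mat_witI[OF _ _ _ A M])
    show "?T' * ?T = 1\<^sub>m ?n" "?T * ?T' = 1\<^sub>m ?n"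
      unfolding mat_diag_diag using pos
      by (auto simp: mat_diag_def intro!: eq_matI dest!: pos)
    show "?A = ?T' * M * ?T"
    proof (rule eq_matI)
      fix i j assume "i < dim_row (?T' * M * ?T)" "j < dim_col (?T' * M * ?T)"
      hence ij: "i < ?n" "j < ?n" by (auto simp: mat_diag_def)
      have "(?T' * M * ?T) $$ (i, j) = 1 / sqrt (\<upsilon> (vs ! i)) * M $$ (i, j) * sqrt (\<upsilon> (vs ! j))"
        using ij M by (simp add: mat_diag_mult_left[of _ _ ?n] mat_diag_mult_right[of _ ?n])
      also have "\<dots> = ?A $$ (i, j)"
        using ij pos[of i] pos[of j]
        by (simp add: M_def weighted_laplacian_mat_def weighted_laplacian_def field_simps)
      finally show "?A $$ (i, j) = (?T' * M * ?T) $$ (i, j)" ..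
    qed (use A in \<open>auto simp: mat_diag_def\<close>)
  qed auto
  thus ?thesis by (auto simp: similar_mat_def)
qed

text \<open>
  The columns of the diagonalizing orthogonal matrix, divided by \<open>\<surd>\<upsilon>\<close>, are the eigenfunctions.
  As functions on the vertices they do not refer to positions in \<open>vs\<close>, so that graphs with
  different vertex sets can be compared.
\<close>

lemma weighted_laplacian_orthonormal_diagonalization:
  assumes G: "weighted_multigraph G \<upsilon> \<epsilon>" and vs: "distinct vs" "set vs = verts G"
  defines "es \<equiv> real_eigenvalues (weighted_laplacian_mat vs G \<upsilon> \<epsilon>)"
  obtains b :: "nat \<Rightarrow> 'v \<Rightarrow> real" where
    "length es = card (verts G)" "sorted es"
    "\<And>f. weighted_sq_norm G \<upsilon> f
        = (\<Sum>k<card (verts G). (\<Sum>v\<in>verts G. \<upsilon> v * b k v * f v)\<^sup>2)"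
    "\<And>f. dirichlet_energy G \<epsilon> f
        = (\<Sum>k<card (verts G). es ! k * (\<Sum>v\<in>verts G. \<upsilon> v * b k v * f v)\<^sup>2)"
    "\<And>k l. k < card (verts G) \<Longrightarrow> l < card (verts G) \<Longrightarrow>
        (\<Sum>v\<in>verts G. \<upsilon> v * b k v * b l v) = (if k = l then 1 else 0)"
proof -
  define n where "n = length vs"
  have n: "n = card (verts G)" using vs distinct_card by (fastforce simp: n_def)
  have bij: "bij_betw ((!) vs) {..<n} (verts G)"
    using bij_betw_nth[OF vs(1), of "{..<n}" "verts G"] vs by (simp add: n_def)
  have sumV: "(\<Sum>v\<in>verts G. g v) = (\<Sum>i<n. g (vs ! i))" for g :: "'v \<Rightarrow> real"
    using sum.reindex_bij_betw[OF bij, of g] by simp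
  have fin: "finite (verts G)" using G by (simp add: weighted_multigraph_def multigraph_def)
  have pos: "\<upsilon> (vs ! i) > 0" if "i < n" for i
    using G vs that by (auto simp: weighted_multigraph_def n_def)
  define M where "M = mat n n (\<lambda>(i, j).
    laplacian G \<epsilon> (vs ! i) (vs ! j) / (sqrt (\<upsilon> (vs ! i)) * sqrt (\<upsilon> (vs ! j))))"
  have M: "M \<in> carrier_mat n n" by (simp add: M_def)
  have MT: "M\<^sup>T = M" by (rule eq_matI) (auto simp: M_def laplacian_def edge_weight_commute mult.commute)
  from real_spectral_theorem[OF M MT] obtain U es' where U: "length es' = n" "sorted es'"
    "similar_mat_wit M (mat_diag n (\<lambda>i. es' ! i)) U (U\<^sup>T)" by blast
  note UM = similar_mat_witD2[OF M U(3)]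
  have "similar_mat (weighted_laplacian_mat vs G \<upsilon> \<epsilon>) M"
    using weighted_laplacian_similar_symmetrized[OF G vs(2)] by (simp add: M_def n_def)
  moreover have "similar_mat M (mat_diag n (\<lambda>i. es' ! i))" using U(3) by (auto simp: similar_mat_def)
  ultimately have "similar_mat (weighted_laplacian_mat vs G \<upsilon> \<epsilon>) (mat_diag n (\<lambda>i. es' ! i))"
    by (rule similar_mat_trans)
  from real_eigenvalues_similar_diag[OF this U(1,2)] have es: "es = es'" by (simp add: es_def)
  have UUT: "(\<Sum>k<n. U $$ (i, k) * U $$ (j, k)) = (if i = j then 1 else 0)" if "i < n" "j < n" for i j
    using arg_cong[OF UM(1), of "\<lambda>A. A $$ (i, j)"] that UM(6)
    by (simp add: scalar_prod_def atLeast0LessThan)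
  have UTU: "(\<Sum>i<n. U $$ (i, k) * U $$ (i, l)) = (if k = l then 1 else 0)" if "k < n" "l < n" for k l
    using arg_cong[OF UM(2), of "\<lambda>A. A $$ (k, l)"] that UM(6)
    by (simp add: scalar_prod_def atLeast0LessThan)
  have UDU: "(\<Sum>k<n. es ! k * (U $$ (i, k) * U $$ (j, k))) = M $$ (i, j)" if "i < n" "j < n" for i j
    using arg_cong[OF UM(3), of "\<lambda>A. A $$ (i, j)"] that UM(6)
    by (simp add: scalar_prod_def atLeast0LessThan mat_diag_mult_right[of _ n] es mult_ac)
  define idx where "idx = the_inv_into {..<n} ((!) vs)"
  have idx: "idx (vs ! i) = i" if "i < n" for i
    unfolding idx_def using bij that by (intro the_inv_into_f_f) (auto simp: bij_betw_def)
  define b where "b k v = U $$ (idx v, k) / sqrt (\<upsilon> v)" for k v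
  have coef: "(\<Sum>v\<in>verts G. \<upsilon> v * b k v * f v) = (\<Sum>i<n. sqrt (\<upsilon> (vs ! i)) * f (vs ! i) * U $$ (i, k))"
    for k f
    unfolding sumV
  proof (intro sum.cong refl)
    fix i assume "i \<in> {..<n}"
    hence i: "i < n" by simp
    have "\<upsilon> (vs ! i) = sqrt (\<upsilon> (vs ! i)) * sqrt (\<upsilon> (vs ! i))" using pos[OF i] by simp
    thus "\<upsilon> (vs ! i) * b k (vs ! i) * f (vs ! i) = sqrt (\<upsilon> (vs ! i)) * f (vs ! i) * U $$ (i, k)"
      using pos[OF i] idx[OF i] by (simp add: b_def field_simps)
  qed
  \<comment> \<open>Taking \<open>c = 1\<close> gives Parseval's identity, taking \<open>c = es\<close> gives the energy.\<close>
  have quad: "(\<Sum>k<n. c k * (\<Sum>v\<in>verts G. \<upsilon> v * b k v * f v)\<^sup>2) =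
      (\<Sum>i<n. \<Sum>j<n. (sqrt (\<upsilon> (vs ! i)) * f (vs ! i)) * (sqrt (\<upsilon> (vs ! j)) * f (vs ! j)) *
        (\<Sum>k<n. c k * (U $$ (i, k) * U $$ (j, k))))" (is "_ = (\<Sum>i<n. \<Sum>j<n. ?x i * ?x j * _)") for c f
  proof -
    have "(\<Sum>k<n. c k * (\<Sum>v\<in>verts G. \<upsilon> v * b k v * f v)\<^sup>2) =
      (\<Sum>k<n. \<Sum>i<n. \<Sum>j<n. ?x i * ?x j * (c k * (U $$ (i, k) * U $$ (j, k))))"
      unfolding coef by (simp add: power2_eq_square sum_product sum_distrib_left mult_ac)
    also have "\<dots> = (\<Sum>i<n. \<Sum>k<n. \<Sum>j<n. ?x i * ?x j * (c k * (U $$ (i, k) * U $$ (j, k))))"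
      by (rule sum.swap)
    also have "\<dots> = (\<Sum>i<n. \<Sum>j<n. \<Sum>k<n. ?x i * ?x j * (c k * (U $$ (i, k) * U $$ (j, k))))"
      by (intro sum.cong refl sum.swap)
    finally show ?thesis by (simp add: sum_distrib_left)
  qed
  show thesis
  proof (rule that[of b])
    show "length es = card (verts G)" "sorted es" using U es n by auto
    fix f
    have "(\<Sum>k<n. 1 * (\<Sum>v\<in>verts G. \<upsilon> v * b k v * f v)\<^sup>2) =
      (\<Sum>i<n. \<Sum>j<n. if i = j then (sqrt (\<upsilon> (vs ! i)) * f (vs ! i))\<^sup>2 else 0)"
      unfolding quad by (intro sum.cong refl) (simp add: UUT power2_eq_square)
    also have "\<dots> = weighted_sq_norm G \<upsilon> f"
      unfolding weighted_sq_norm_def sumV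
      by (intro sum.cong refl) (simp add: power_mult_distrib pos less_imp_le)
    finally show "weighted_sq_norm G \<upsilon> f = (\<Sum>k<card (verts G). (\<Sum>v\<in>verts G. \<upsilon> v * b k v * f v)\<^sup>2)"
      by (simp add: n)
    have "(\<Sum>k<n. es ! k * (\<Sum>v\<in>verts G. \<upsilon> v * b k v * f v)\<^sup>2) =
      (\<Sum>i<n. \<Sum>j<n. f (vs ! i) * laplacian G \<epsilon> (vs ! i) (vs ! j) * f (vs ! j))"
      unfolding quad
    proof (intro sum.cong refl)
      fix i j assume "i \<in> {..<n}" "j \<in> {..<n}"
      hence "i < n" "j < n" by auto
      thus "(sqrt (\<upsilon> (vs ! i)) * f (vs ! i)) * (sqrt (\<upsilon> (vs ! j)) * f (vs ! j)) *
        (\<Sum>k<n. es ! k * (U $$ (i, k) * U $$ (j, k))) =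
        f (vs ! i) * laplacian G \<epsilon> (vs ! i) (vs ! j) * f (vs ! j)"
        using pos[of i] pos[of j] by (simp add: UDU M_def)
    qed
    thus "dirichlet_energy G \<epsilon> f
        = (\<Sum>k<card (verts G). es ! k * (\<Sum>v\<in>verts G. \<upsilon> v * b k v * f v)\<^sup>2)"
      unfolding dirichlet_energy_eq_laplacian_form[OF fin] sumV by (simp add: n sumV)
  next
    fix k l assume "k < card (verts G)" "l < card (verts G)"
    hence kl: "k < n" "l < n" by (auto simp: n)
    have "(\<Sum>v\<in>verts G. \<upsilon> v * b k v * b l v) = (\<Sum>i<n. U $$ (i, k) * U $$ (i, l))"
      unfolding coef 
    proof (intro sum.cong refl)
      fix i assume "i \<in> {..<n}"
      thus "sqrt (\<upsilon> (vs ! i)) * b l (vs ! i) * U $$ (i, k) = U $$ (i, k) * U $$ (i, l)"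
        using pos[of i] idx[of i] by (simp add: b_def)
    qed
    thus "(\<Sum>v\<in>verts G. \<upsilon> v * b k v * b l v) = (if k = l then 1 else 0)"
      using UTU[OF kl] by simp
  qed
qed

text \<open>
  The functional \<open>a k\<close> is the inner product with the \<open>k\<close>-th eigenfunction.  If the coefficients
  of \<open>f\<close> vanish before (after) position \<open>p\<close>, then the energy only involves eigenvalues at least
  (at most) the \<open>p\<close>-th.  Each eigenvalue is the energy of its eigenfunction, hence nonnegative.
\<close>

lemma weighted_laplacian_rayleigh_bounds:
  assumes G: "weighted_multigraph G \<upsilon> \<epsilon>" and vs: "distinct vs" "set vs = verts G"
  defines "es \<equiv> real_eigenvalues (weighted_laplacian_mat vs G \<upsilon> \<epsilon>)"
  obtains a :: "nat \<Rightarrow> 'v \<Rightarrow> real" where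
    "\<And>p f. p < card (verts G) \<Longrightarrow> (\<And>k. k < p \<Longrightarrow> (\<Sum>v\<in>verts G. a k v * f v) = 0) \<Longrightarrow>
        es ! p * weighted_sq_norm G \<upsilon> f \<le> dirichlet_energy G \<epsilon> f"
    "\<And>p f. p < card (verts G) \<Longrightarrow>
        (\<And>k. p < k \<Longrightarrow> k < card (verts G) \<Longrightarrow> (\<Sum>v\<in>verts G. a k v * f v) = 0) \<Longrightarrow>
        dirichlet_energy G \<epsilon> f \<le> es ! p * weighted_sq_norm G \<upsilon> f"
    "\<And>p. p < card (verts G) \<Longrightarrow> es ! p \<ge> 0"
proof (rule weighted_laplacian_orthonormal_diagonalization[OF G vs, folded es_def])
  let ?n = "card (verts G)"
  fix b assume b: "length es = ?n" "sorted es"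
    "\<And>f. weighted_sq_norm G \<upsilon> f = (\<Sum>k<?n. (\<Sum>v\<in>verts G. \<upsilon> v * b k v * f v)\<^sup>2)"
    "\<And>f. dirichlet_energy G \<epsilon> f
        = (\<Sum>k<?n. es ! k * (\<Sum>v\<in>verts G. \<upsilon> v * b k v * f v)\<^sup>2)"
    "\<And>k l. k < ?n \<Longrightarrow> l < ?n \<Longrightarrow>
        (\<Sum>v\<in>verts G. \<upsilon> v * b k v * b l v) = (if k = l then 1 else 0)"
  define c where "c k f = (\<Sum>v\<in>verts G. \<upsilon> v * b k v * f v)" for k and f :: "'v \<Rightarrow> real"
  note b34 = b(3,4)[folded c_def]
  have mono: "es ! i \<le> es ! j" if "i \<le> j" "j < ?n" for i j
    using b(1,2) that by (simp add: sorted_nth_mono)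
  show thesis
  proof (rule that[of "\<lambda>k v. \<upsilon> v * b k v"], unfold c_def[symmetric])
    fix p f assume p: "p < ?n" and f: "\<And>k. k < p \<Longrightarrow> c k f = 0"
    have "es ! p * (c k f)\<^sup>2 \<le> es ! k * (c k f)\<^sup>2" if "k < ?n" for k
      using f[of k] mono[of p k] that by (cases "k < p") (auto intro: mult_right_mono)
    thus "es ! p * weighted_sq_norm G \<upsilon> f \<le> dirichlet_energy G \<epsilon> f"
      unfolding b34 sum_distrib_left by (intro sum_mono) auto
  next
    fix p f assume p: "p < ?n" and f: "\<And>k. p < k \<Longrightarrow> k < ?n \<Longrightarrow> c k f = 0"
    have "es ! k * (c k f)\<^sup>2 \<le> es ! p * (c k f)\<^sup>2" if "k < ?n" for k
      using f[of k] mono[of k p] that p by (cases "p < k") (auto intro: mult_right_mono)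
    thus "dirichlet_energy G \<epsilon> f \<le> es ! p * weighted_sq_norm G \<upsilon> f"
      unfolding b34 sum_distrib_left by (intro sum_mono) auto
  next
    fix p assume p: "p < ?n"
    have "dirichlet_energy G \<epsilon> (b p) = (\<Sum>k<?n. if k = p then es ! k else 0)"
      unfolding b34 using p by (intro sum.cong refl) (simp add: c_def b(5))
    hence "dirichlet_energy G \<epsilon> (b p) = es ! p" using p by simp
    moreover have "dirichlet_energy G \<epsilon> (b p) \<ge> 0"
      unfolding dirichlet_energy_def using G
      by (auto intro!: divide_nonneg_nonneg sum_nonneg mult_nonneg_nonneg edge_weight_nonneg
          simp: weighted_multigraph_def)
    ultimately show "es ! p \<ge> 0" by simp
  qed
qed

section \<open>Comparing two weighted multigraphs\<close>

text \<open>
  The Courant-Fischer argument in the form of an equation count.  Besides the constraints \<open>cs\<close>,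
  \<open>f\<close> is required to be orthogonal to the first \<open>p\<close> eigenfunctions of \<open>A\<close> and to those of \<open>B\<close>
  after position \<open>q\<close>.  The hypothesis \<open>codim\<close> leaves a nonzero \<open>f\<close>, which witnesses the inequality.
  The two vertex sets may differ; \<open>V\<close> is where \<open>f\<close> lives, and allowing \<open>A\<close> or \<open>B\<close> to be the
  smaller graph makes the lemma serve both bounds.
\<close>

lemma weighted_laplacian_eigenvalue_comparison:
  fixes A B :: "('v, 'e) multigraph"
  assumes A: "weighted_multigraph A \<upsilon> \<epsilon>" "distinct xs" "set xs = verts A"
    and B: "weighted_multigraph B \<upsilon> \<epsilon>" "distinct ys" "set ys = verts B"
    and V: "finite V" "verts A \<subseteq> V" "verts B \<subseteq> V"
    and pq: "p < card (verts A)" "q < card (verts B)"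
    and codim: "p + (card (verts B) - 1 - q) + length cs < card V"
    and cmp: "\<And>f. (\<And>c. c \<in> set cs \<Longrightarrow> (\<Sum>v\<in>V. c v * f v) = 0) \<Longrightarrow> \<exists>v\<in>V. f v \<noteq> 0 \<Longrightarrow>
      weighted_sq_norm A \<upsilon> f > 0 \<and> weighted_sq_norm B \<upsilon> f \<le> weighted_sq_norm A \<upsilon> f \<and>
      dirichlet_energy A \<epsilon> f \<le> dirichlet_energy B \<epsilon> f"
  shows "real_eigenvalues (weighted_laplacian_mat xs A \<upsilon> \<epsilon>) ! p
       \<le> real_eigenvalues (weighted_laplacian_mat ys B \<upsilon> \<epsilon>) ! q" (is "?\<alpha> \<le> ?\<beta>")
proof -
  from weighted_laplacian_rayleigh_bounds[OF A] obtain a where a: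
    "\<And>f. (\<And>k. k < p \<Longrightarrow> (\<Sum>v\<in>verts A. a k v * f v) = 0) \<Longrightarrow>
        ?\<alpha> * weighted_sq_norm A \<upsilon> f \<le> dirichlet_energy A \<epsilon> f"
    using pq(1) by metis
  from weighted_laplacian_rayleigh_bounds[OF B] obtain b where b:
    "\<And>f. (\<And>k. q < k \<Longrightarrow> k < card (verts B) \<Longrightarrow> (\<Sum>v\<in>verts B. b k v * f v) = 0) \<Longrightarrow>
        dirichlet_energy B \<epsilon> f \<le> ?\<beta> * weighted_sq_norm B \<upsilon> f" "?\<beta> \<ge> 0"
    using pq(2) by metis
  define on where "on X g v = (if v \<in> X then g v else 0)" for X and g :: "'v \<Rightarrow> real" and v
  have on: "(\<Sum>v\<in>V. on X g v * f v) = (\<Sum>v\<in>X. g v * f v)" if "X \<subseteq> V" for X g f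
    using V(1) that by (intro sum.mono_neutral_cong_right) (auto simp: on_def)
  define eqs where "eqs = map (\<lambda>k. on (verts A) (a k)) [0..<p]
    @ map (\<lambda>k. on (verts B) (b k)) [q + 1..<card (verts B)] @ cs"
  have "length eqs < card V" using codim by (simp add: eqs_def)
  then obtain f where f: "\<exists>v\<in>V. f v \<noteq> 0" "\<And>c. c \<in> set eqs \<Longrightarrow> (\<Sum>v\<in>V. c v * f v) = 0"
    using homogeneous_system_nontrivial_solution[OF V(1)] by metis
  have lo: "?\<alpha> * weighted_sq_norm A \<upsilon> f \<le> dirichlet_energy A \<epsilon> f"
  proof (rule a)
    fix k assume "k < p"
    hence "on (verts A) (a k) \<in> set eqs" by (simp add: eqs_def)
    from f(2)[OF this] show "(\<Sum>v\<in>verts A. a k v * f v) = 0" using on[OF V(2)] by simp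
  qed
  have hi: "dirichlet_energy B \<epsilon> f \<le> ?\<beta> * weighted_sq_norm B \<upsilon> f"
  proof (rule b(1))
    fix k assume "q < k" "k < card (verts B)"
    hence "on (verts B) (b k) \<in> set eqs" by (simp add: eqs_def)
    from f(2)[OF this] show "(\<Sum>v\<in>verts B. b k v * f v) = 0" using on[OF V(3)] by simp
  qed
  have c: "weighted_sq_norm A \<upsilon> f > 0" "weighted_sq_norm B \<upsilon> f \<le> weighted_sq_norm A \<upsilon> f"
      "dirichlet_energy A \<epsilon> f \<le> dirichlet_energy B \<epsilon> f"
    using cmp[of f] f by (auto simp: eqs_def)
  have "?\<alpha> * weighted_sq_norm A \<upsilon> f \<le> ?\<beta> * weighted_sq_norm B \<upsilon> f" using lo hi c(3) by linarith
  also have "\<dots> \<le> ?\<beta> * weighted_sq_norm A \<upsilon> f" using b(2) c(2) by (rule mult_left_mono[rotated])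
  finally show ?thesis using c(1) by simp
qed

section \<open>Deleting edges and isolated vertices\<close>

lemma edge_weight_del_edges:
  assumes "finite (edges G)" "R \<subseteq> edges G"
  shows "edge_weight G \<epsilon> u v = edge_weight (del_edges G R) \<epsilon> u v + edge_weight (edge_subgraph G R) \<epsilon> u v"
proof -
  have "{e \<in> edges G. ends G e = Upair u v} =
    {e \<in> edges G - R. ends G e = Upair u v} \<union> {e \<in> R. ends G e = Upair u v}" using assms by auto
  hence "(\<Sum>e\<in>{e \<in> edges G. ends G e = Upair u v}. \<epsilon> e) =
    (\<Sum>e\<in>{e \<in> edges G - R. ends G e = Upair u v}. \<epsilon> e) + (\<Sum>e\<in>{e \<in> R. ends G e = Upair u v}. \<epsilon> e)"
    using assms by (simp add: finite_subset sum.union_disjoint disjoint_iff)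
  thus ?thesis by (simp add: edge_weight_def del_edges_def edge_subgraph_def distrib_left)
qed

lemma edge_weight_isolated:
  assumes "finite (edges G)" "u \<in> isolated_verts G"
  shows "edge_weight G \<epsilon> u v = 0"
proof -
  have "{e \<in> edges G. u \<in> set_uprod (ends G e)} = {}"
    using assms by (simp add: isolated_verts_def vertex_degree_def)
  moreover have "u \<in> set_uprod (ends G e)" if "ends G e = Upair u v" for e using that by simp
  ultimately have no_edge: "{e \<in> edges G. ends G e = Upair u v} = {}" by blast
  show ?thesis unfolding edge_weight_def no_edge by simp
qed

lemma edge_weight_del_verts:
  assumes "u \<notin> S" "v \<notin> S"
  shows "edge_weight (del_verts G S) \<epsilon> u v = edge_weight G \<epsilon> u v"
proof -
  have "{e \<in> edges (del_verts G S). ends (del_verts G S) e = Upair u v} =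
    {e \<in> edges G. ends G e = Upair u v}" using assms by (auto simp: del_verts_def)
  thus ?thesis by (simp add: edge_weight_def)
qed

lemma dirichlet_energy_del_isolated_verts:
  assumes fin: "finite (verts G)" "finite (edges G)" and S: "S \<subseteq> isolated_verts G"
  shows "dirichlet_energy (del_verts G S) \<epsilon> f = dirichlet_energy G \<epsilon> f"
proof -
  have 0: "edge_weight G \<epsilon> u v = 0" if "u \<in> S \<or> v \<in> S" for u v
    using that S edge_weight_isolated[OF fin(2)] edge_weight_commute[of G \<epsilon> u v] by (metis subsetD)
  have vS: "verts (del_verts G S) = verts G - S" by (simp add: del_verts_def)
  have "(\<Sum>u\<in>verts G - S. \<Sum>v\<in>verts G - S. edge_weight (del_verts G S) \<epsilon> u v * (f u - f v)\<^sup>2)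
      = (\<Sum>u\<in>verts G - S. \<Sum>v\<in>verts G. edge_weight G \<epsilon> u v * (f u - f v)\<^sup>2)"
    using fin by (intro sum.cong[OF refl] sum.mono_neutral_cong_left)
      (auto simp: 0 edge_weight_del_verts)
  also have "\<dots> = (\<Sum>u\<in>verts G. \<Sum>v\<in>verts G. edge_weight G \<epsilon> u v * (f u - f v)\<^sup>2)"
    using fin by (intro sum.mono_neutral_cong_left) (auto simp: 0)
  finally show ?thesis by (simp add: dirichlet_energy_def vS)
qed

lemma edge_weight_eq_0_if_not_adjacent:
  assumes "(u, v) \<notin> adjacency G"
  shows "edge_weight G \<epsilon> u v = 0"
  using assms by (auto simp: edge_weight_def adjacency_def intro!: sum.neutral)

text \<open>
  Being constant on the components costs one equation for each vertex that is not the chosen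
  representative of its component: its value must agree with the one at the representative.
\<close>

lemma component_functionals:
  fixes C :: "('v, 'e) multigraph"
  assumes C: "multigraph C"
  obtains cs :: "('v \<Rightarrow> real) list" where
    "length cs + card (components C) = card (verts C)"
    "\<And>V f u v. finite V \<Longrightarrow> verts C \<subseteq> V \<Longrightarrow> (\<And>c. c \<in> set cs \<Longrightarrow> (\<Sum>v\<in>V. c v * f v) = 0) \<Longrightarrow>
      (u, v) \<in> adjacency C \<Longrightarrow> f u = f v"
proof -
  have fin: "finite (verts C)" using C by (simp add: multigraph_def)
  have "sym (adjacency C)" by (force simp: sym_def adjacency_def)
  hence "sym ((adjacency C)\<^sup>*)" by (rule sym_rtrancl)
  hence eq: "equiv (verts C) (connected_rel C)"
    unfolding connected_rel_def
    by (intro equivI refl_onI symI transI) (auto elim: symE intro: rtrancl_trans)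
  define cls where "cls v = connected_rel C `` {v}" for v
  define rep where "rep X = (SOME x. x \<in> X)" for X :: "'v set"
  have rep: "rep X \<in> verts C" "cls (rep X) = X" if X: "X \<in> components C" for X
  proof -
    from X obtain x where x: "x \<in> verts C" "X = cls x"
      by (auto simp: components_def cls_def elim: quotientE)
    hence "x \<in> X" using equiv_class_self[OF eq] by (simp add: cls_def)
    hence "rep X \<in> X" unfolding rep_def by (rule someI)
    hence r: "(x, rep X) \<in> connected_rel C" using x by (simp add: cls_def)
    thus "rep X \<in> verts C" by (simp add: connected_rel_def)
    show "cls (rep X) = X" using equiv_class_eq[OF eq r] x by (simp add: cls_def)
  qed
  define reps where "reps = rep ` components C"
  have "inj_on rep (components C)" using rep(2) by (metis inj_onI)
  hence cr: "card reps = card (components C)" by (simp add: reps_def card_image)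
  have rs: "reps \<subseteq> verts C" using rep(1) by (auto simp: reps_def)
  obtain zs where zs: "set zs = verts C - reps" "distinct zs"
    using finite_distinct_list[of "verts C - reps"] fin by auto
  define cs where "cs = map (\<lambda>z v. (if v = z then 1 else 0) - (if v = rep (cls z) then 1 else 0 :: real)) zs"
  show thesis
  proof (rule that[of cs])
    have "length cs = card (verts C - reps)" using zs distinct_card by (fastforce simp: cs_def)
    thus "length cs + card (components C) = card (verts C)"
      using rs fin by (simp add: card_Diff_subset finite_subset cr[symmetric] card_mono)
  next
    fix V :: "'v set" and f :: "'v \<Rightarrow> real" and u v
    assume V: "finite V" "verts C \<subseteq> V" and f: "\<And>c. c \<in> set cs \<Longrightarrow> (\<Sum>v\<in>V. c v * f v) = 0"
      and uv: "(u, v) \<in> adjacency C"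
    have cmp: "cls z \<in> components C" if "z \<in> verts C" for z
      using that by (simp add: components_def cls_def quotientI)
    have frep: "f z = f (rep (cls z))" if z: "z \<in> verts C" for z
    proof (cases "z \<in> reps")
      case True
      thus ?thesis using rep(2) by (auto simp: reps_def)
    next
      case False
      hence "(\<lambda>v. (if v = z then 1 else 0) - (if v = rep (cls z) then 1 else 0)) \<in> set cs"
        using z zs by (auto simp: cs_def)
      from f[OF this] have "(\<Sum>v\<in>V. (if v = z then f v else 0) - (if v = rep (cls z) then f v else 0)) = 0"
        by (simp add: left_diff_distrib if_distrib[of "\<lambda>x. x * _"] cong: if_cong)
      moreover have "z \<in> V" "rep (cls z) \<in> V" using z rep(1)[OF cmp] V by auto
      ultimately show ?thesis using V(1) by (simp add: sum_subtractf)
    qed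
    from uv obtain e where e: "e \<in> edges C" "ends C e = Upair u v" by (auto simp: adjacency_def)
    hence V': "u \<in> verts C" "v \<in> verts C" using C by (force simp: multigraph_def)+
    hence "(u, v) \<in> connected_rel C" using uv by (auto simp: connected_rel_def)
    hence "cls u = cls v" unfolding cls_def by (rule equiv_class_eq[OF eq])
    thus "f u = f v" using frep V' by simp
  qed
qed

section \<open>Interlacing\<close>

theorem corollary5p11:
  fixes G H :: "('v, 'e) multigraph"
    and \<upsilon> :: "'v \<Rightarrow> real" and \<epsilon> :: "'e \<Rightarrow> real"
    and R :: "'e set" and S :: "'v set"
    and vs ws :: "'v list"
    and n k s c :: nat and i :: int
  assumes "weighted_multigraph G \<upsilon> \<epsilon>" and "card (verts G) = n"
    and "R \<subseteq> edges G"
    and "S \<subseteq> isolated_verts (del_edges G R)" and "card S = k"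
    and "H = del_verts (del_edges G R) S"
    and "card (verts (edge_subgraph G R)) = s"
    and "card (components (edge_subgraph G R)) = c"
    and "distinct vs" and "set vs = verts G"
    and "distinct ws" and "set ws = verts H"
    and "1 \<le> i" and "i \<le> int n - int k"
  shows "(1 \<le> i - int s + int c + int k \<and> i - int s + int c + int k \<le> int n \<longrightarrow>
            laplacian_eigenvalue vs G \<upsilon> \<epsilon> (i - int s + int c + int k)
              \<le> laplacian_eigenvalue ws H \<upsilon> \<epsilon> i) \<and>
         (1 \<le> i + int k \<and> i + int k \<le> int n \<longrightarrow>
            laplacian_eigenvalue ws H \<upsilon> \<epsilon> i \<le> laplacian_eigenvalue vs G \<upsilon> \<epsilon> (i + int k))"
proof -
  let ?V = "verts G" and ?GR = "del_edges G R" and ?C = "edge_subgraph G R"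
  have G: "finite ?V" "finite (edges G)" "\<And>e. e \<in> edges G \<Longrightarrow> set_uprod (ends G e) \<subseteq> ?V"
    and \<upsilon>: "\<And>v. v \<in> ?V \<Longrightarrow> \<upsilon> v > 0" and \<epsilon>: "\<And>e. e \<in> edges G \<Longrightarrow> \<epsilon> e > 0"
    using assms(1) by (auto simp: weighted_multigraph_def multigraph_def)
  have SV: "S \<subseteq> ?V" using assms(4) by (auto simp: isolated_verts_def del_edges_def)
  have VH: "verts H = ?V - S" by (simp add: assms(6) del_verts_def del_edges_def)
  have finS: "finite S" using SV G(1) by (rule finite_subset)
  have cH: "card (verts H) = n - k" "k \<le> n"
    using SV G(1) assms(2,5) finS by (auto simp: VH card_Diff_subset card_mono)
  have H: "weighted_multigraph H \<upsilon> \<epsilon>"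
    using G \<upsilon> \<epsilon> by (auto simp: weighted_multigraph_def multigraph_def assms(6) del_verts_def del_edges_def)
  have CV: "verts ?C \<subseteq> ?V" using G(3) assms(3) by (auto simp: edge_subgraph_def)
  have C: "multigraph ?C"
    using G assms(3) CV by (auto simp: multigraph_def edge_subgraph_def intro: finite_subset)
  have wC: "edge_weight ?C \<epsilon> u v \<ge> 0" for u v
    using \<epsilon> assms(3) by (intro edge_weight_nonneg) (auto simp: edge_subgraph_def)
  have energy: "dirichlet_energy G \<epsilon> f = dirichlet_energy H \<epsilon> f +
      (\<Sum>u\<in>?V. \<Sum>v\<in>?V. edge_weight ?C \<epsilon> u v * (f u - f v)\<^sup>2) / 2" for f
  proof -
    have "dirichlet_energy H \<epsilon> f = dirichlet_energy ?GR \<epsilon> f"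
      unfolding assms(6) using G assms(4)
      by (intro dirichlet_energy_del_isolated_verts) (auto simp: del_edges_def)
    moreover have "verts ?GR = ?V" by (simp add: del_edges_def)
    ultimately show ?thesis
      by (simp add: dirichlet_energy_def edge_weight_del_edges[OF G(2) assms(3)] distrib_right
          sum.distrib add_divide_distrib)
  qed
  have normG: "weighted_sq_norm G \<upsilon> f = weighted_sq_norm H \<upsilon> f + (\<Sum>v\<in>S. \<upsilon> v * (f v)\<^sup>2)" for f
    using sum.subset_diff[OF SV G(1)] by (simp add: weighted_sq_norm_def VH)
  have posG: "weighted_sq_norm G \<upsilon> f > 0" if "\<exists>v\<in>?V. f v \<noteq> 0" for f
  proof -
    from that obtain v where "v \<in> ?V" "f v \<noteq> 0" by blast
    thus ?thesis unfolding weighted_sq_norm_def using G(1) \<upsilon>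
      by (intro sum_pos2[of _ v]) (auto simp: less_imp_le)
  qed
  \<comment> \<open>Lists of eigenvalues are indexed from 0, so \<open>p\<close> is the position of \<open>\<mu>\<^sub>i\<close>.\<close>
  define p where "p = nat (i - 1)"
  have p: "i = int p + 1" "p < n - k" using assms(13,14) by (auto simp: p_def)
  have "laplacian_eigenvalue vs G \<upsilon> \<epsilon> (i - int s + int c + int k) \<le> laplacian_eigenvalue ws H \<upsilon> \<epsilon> i"
    if j: "1 \<le> i - int s + int c + int k" "i - int s + int c + int k \<le> int n"
  proof (rule component_functionals[OF C, unfolded assms(7,8)])
    fix cs :: "('v \<Rightarrow> real) list"
    assume cs: "length cs + c = s"
      "\<And>V f u v. finite V \<Longrightarrow> verts ?C \<subseteq> V \<Longrightarrow> (\<And>c. c \<in> set cs \<Longrightarrow> (\<Sum>v\<in>V. c v * f v) = 0) \<Longrightarrow>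
        (u, v) \<in> adjacency ?C \<Longrightarrow> f u = f v"
    define q where "q = nat (i - int s + int c + int k - 1)"
    have q: "q + length cs = p + k" "q < n" using j cs(1) p(1) by (auto simp: q_def)
    have "real_eigenvalues (weighted_laplacian_mat vs G \<upsilon> \<epsilon>) ! q
       \<le> real_eigenvalues (weighted_laplacian_mat ws H \<upsilon> \<epsilon>) ! p"
    proof (rule weighted_laplacian_eigenvalue_comparison[OF assms(1,9,10) H assms(11,12) G(1)])
      show "q + (card (verts H) - 1 - p) + length cs < card ?V"
        using q p cH assms(2) by linarith
    next
      fix f assume f: "\<And>c. c \<in> set cs \<Longrightarrow> (\<Sum>v\<in>?V. c v * f v) = 0" and nz: "\<exists>v\<in>?V. f v \<noteq> 0"
      have "edge_weight ?C \<epsilon> u v * (f u - f v)\<^sup>2 = 0" for u v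
        using cs(2)[OF G(1) CV f, of u v] edge_weight_eq_0_if_not_adjacent[of u v ?C \<epsilon>]
        by (cases "(u, v) \<in> adjacency ?C") auto
      hence "dirichlet_energy G \<epsilon> f = dirichlet_energy H \<epsilon> f" by (simp add: energy)
      moreover have "(\<Sum>v\<in>S. \<upsilon> v * (f v)\<^sup>2) \<ge> 0"
        using \<upsilon> SV by (intro sum_nonneg) (auto simp: less_imp_le subset_iff)
      ultimately show "weighted_sq_norm G \<upsilon> f > 0 \<and> weighted_sq_norm H \<upsilon> f \<le> weighted_sq_norm G \<upsilon> f \<and>
        dirichlet_energy G \<epsilon> f \<le> dirichlet_energy H \<epsilon> f"
        using posG[OF nz] normG[of f] by simp
    qed (use q p cH assms(2) in \<open>auto simp: VH\<close>)
    thus ?thesis by (simp add: laplacian_eigenvalue_def q_def p_def)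
  qed
  moreover have "laplacian_eigenvalue ws H \<upsilon> \<epsilon> i \<le> laplacian_eigenvalue vs G \<upsilon> \<epsilon> (i + int k)"
  proof -
    obtain zs where zs: "set zs = S" "distinct zs" using finite_distinct_list[OF finS] by auto
    define cs where "cs = map (\<lambda>z v. if v = z then 1 else 0 :: real) zs"
    have lcs: "length cs = k" using zs assms(5) distinct_card by (fastforce simp: cs_def)
    have "real_eigenvalues (weighted_laplacian_mat ws H \<upsilon> \<epsilon>) ! p
       \<le> real_eigenvalues (weighted_laplacian_mat vs G \<upsilon> \<epsilon>) ! (p + k)"
    proof (rule weighted_laplacian_eigenvalue_comparison[OF H assms(11,12) assms(1,9,10) G(1)])
      show "p + (card ?V - 1 - (p + k)) + length cs < card ?V"
        using p lcs assms(2) by linarith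
    next
      fix f assume f: "\<And>c. c \<in> set cs \<Longrightarrow> (\<Sum>v\<in>?V. c v * f v) = 0" and nz: "\<exists>v\<in>?V. f v \<noteq> 0"
      have "f z = 0" if z: "z \<in> S" for z
      proof -
        have "(\<lambda>v. if v = z then 1 else 0) \<in> set cs" using z zs by (auto simp: cs_def)
        from f[OF this] have "(\<Sum>v\<in>?V. if v = z then f v else 0) = 0"
          by (simp add: if_distrib[of "\<lambda>x. x * _"] cong: if_cong)
        thus ?thesis using z SV G(1) by auto
      qed
      hence "weighted_sq_norm G \<upsilon> f = weighted_sq_norm H \<upsilon> f" by (simp add: normG)
      moreover have "(\<Sum>u\<in>?V. \<Sum>v\<in>?V. edge_weight ?C \<epsilon> u v * (f u - f v)\<^sup>2) \<ge> 0"
        by (intro sum_nonneg mult_nonneg_nonneg wC) auto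
      ultimately show "weighted_sq_norm H \<upsilon> f > 0 \<and> weighted_sq_norm G \<upsilon> f \<le> weighted_sq_norm H \<upsilon> f \<and>
        dirichlet_energy H \<epsilon> f \<le> dirichlet_energy G \<epsilon> f"
        using posG[OF nz] energy[of f] by simp
    qed (use p cH assms(2) in \<open>auto simp: VH\<close>)
    thus ?thesis using p(1) by (simp add: laplacian_eigenvalue_def nat_add_distrib)
  qed
  ultimately show ?thesis by blast
qed

end
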